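(* Let $\mathbb{D}^*=\{z\in\mathbb{C}: 0<|z|<1\}$. Then the injectivity radius of $\mathbb{D}^*$ with respect to the Kobayashi distance is $$\iota^k_{\mathbb{D}^*}=0.$$
   Context: $\mathbb{D}$ is the open unit disk in $\mathbb{C}$, and $\rho_{\mathbb{D}}$ is the Poincaré distance on $\mathbb{D}$ with density $\frac{2}{1-|z|^2}$. For a Riemann surface $X$, the Kobayashi pseudo-distance is $k_X(z_1,z_2)=\inf \sum_{i=1}^m\rho_{\mathbb{D}}(a_i,b_i)$, the infimum over all $m\ge1$, $a_i,b_i\in\mathbb{D}$ and holomorphic $f_i:\mathbb{D}\to X$ with $f_1(a_1)=z_1$, $f_i(b_i)=f_{i+1}(a_{i+1})$ for $1\le i<m$, and $f_m(b_m)=z_2$. Put $B^k_X(z;r)=\{w\in X: k_X(z,w)<r\}$. The injectivity radius function is $\iota^k_X(z)=\sup\{\tanh\frac r2 : r>0,\ B^k_X(z;r)\text{ is simply connected}\}$, and the injectivity radius is $\iota^k_X=\inf_{z\in X}\iota^k_X(z)$. *)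

theory Defs
  imports "HOL-Complex_Analysis.Complex_Analysis"
begin

text \<open>
  Lengths, distances and radii are taken in \<^typ>\<open>ennreal\<close>, so that every infimum and supremum
  below is total, with the usual conventions in the interval from 0 to infinity (the infimum of
  the empty set is infinity, its supremum is 0).
\<close>

text \<open>
  The Lebesgue integral of the nonnegative speed is used because a piecewise continuously
  differentiable path in the sense of \<^const>\<open>valid_path\<close> may have unbounded derivative near the
  finitely many exceptional parameters; a nonrectifiable path then gets length infinity.
\<close>

definition poincare_length :: "(real \<Rightarrow> complex) \<Rightarrow> ennreal" where
  "poincare_length \<gamma> =
     (\<integral>\<^sup>+ t\<in>{0..1}. ennreal (2 / (1 - (norm (\<gamma> t))\<^sup>2) *
        norm (vector_derivative \<gamma> (at t within {0..1}))) \<partial>lborel)"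

definition poincare_dist :: "complex \<Rightarrow> complex \<Rightarrow> ennreal" where
  "poincare_dist a b =
     (INF \<gamma> \<in> {\<gamma>. valid_path \<gamma> \<and> path_image \<gamma> \<subseteq> ball 0 1 \<and> pathstart \<gamma> = a \<and> pathfinish \<gamma> = b}.
        poincare_length \<gamma>)"

text \<open>
  The Riemann surfaces considered here are plane domains, that is, nonempty connected open sets
  \<open>X\<close> with the complex structure and the topology inherited from the complex plane.
\<close>

definition kobayashi_chain ::
  "complex set \<Rightarrow> complex \<Rightarrow> complex \<Rightarrow> nat \<Rightarrow> (nat \<Rightarrow> complex) \<Rightarrow> (nat \<Rightarrow> complex) \<Rightarrow>
     (nat \<Rightarrow> complex \<Rightarrow> complex) \<Rightarrow> bool" where
  "kobayashi_chain X z w m a b f \<longleftrightarrow>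
     1 \<le> m \<and>
     (\<forall>i\<in>{1..m}. a i \<in> ball 0 1 \<and> b i \<in> ball 0 1 \<and>
        f i holomorphic_on ball 0 1 \<and> f i ` ball 0 1 \<subseteq> X) \<and>
     f 1 (a 1) = z \<and>
     (\<forall>i\<in>{1..<m}. f i (b i) = f (i + 1) (a (i + 1))) \<and>
     f m (b m) = w"

definition kobayashi_dist :: "complex set \<Rightarrow> complex \<Rightarrow> complex \<Rightarrow> ennreal" where
  "kobayashi_dist X z w =
     Inf {\<Sum>i=1..m. poincare_dist (a i) (b i) | m a b f. kobayashi_chain X z w m a b f}"

definition kobayashi_ball :: "complex set \<Rightarrow> complex \<Rightarrow> real \<Rightarrow> complex set" where
  "kobayashi_ball X z r = {w \<in> X. kobayashi_dist X z w < ennreal r}"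

definition kobayashi_injectivity_radius_at :: "complex set \<Rightarrow> complex \<Rightarrow> ennreal" where
  "kobayashi_injectivity_radius_at X z =
     Sup {ennreal (tanh (r / 2)) | r. r > 0 \<and> simply_connected (kobayashi_ball X z r)}"

definition kobayashi_injectivity_radius :: "complex set \<Rightarrow> ennreal" where
  "kobayashi_injectivity_radius X = (INF z\<in>X. kobayashi_injectivity_radius_at X z)"

end

theory Submission
  imports Defs
begin

text \<open>
  For \<open>s > 0\<close> the universal covering \<open>\<zeta> \<mapsto> exp (- s (1 + \<zeta>) / (1 - \<zeta>))\<close> of the punctured disk sends
  0 to \<open>exp (-s)\<close>. It sends points at distance \<open>O(1/s)\<close> from 0 to every other point of the circle
  of radius \<open>exp (-s)\<close>, which therefore lies in a Kobayashi ball of radius \<open>O(1/s)\<close>. A set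
  containing this circle but not 0 is not simply connected, so the injectivity radius at
  \<open>exp (-s)\<close> is \<open>O(1/s)\<close>.
\<close>

text \<open>The straight segment from 0 to \<open>b\<close> stays in the disk of radius 1/2, where
  the density is at most 8/3; 4 is a convenient rounding.\<close>

lemma poincare_dist_0_le:
  fixes b :: complex
  assumes "norm b \<le> 1 / 2"
  shows "poincare_dist 0 b \<le> ennreal (4 * norm b)"
proof -
  have norm_le: "norm (linepath 0 b t) \<le> 1 / 2" if "t \<in> {0..1}" for t
  proof -
    have "norm (linepath 0 b t) = t * norm b"
      using that by (simp add: linepath_def)
    also have "\<dots> \<le> 1 * (1 / 2)"
      using that assms by (intro mult_mono) auto
    finally show ?thesis by simp
  qed
  have "path_image (linepath 0 b) \<subseteq> ball 0 1"
    using norm_le unfolding path_image_def by fastforce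
  then have "poincare_dist 0 b \<le> poincare_length (linepath 0 b)"
    unfolding poincare_dist_def by (intro INF_lower) auto
  also have "\<dots> \<le> (\<integral>\<^sup>+ t. ennreal (4 * norm b) * indicator {0..1::real} t \<partial>lborel)"
    unfolding poincare_length_def
  proof (intro nn_integral_mono)
    fix t :: real
    have "2 / (1 - (norm (linepath 0 b t))\<^sup>2) *
        norm (vector_derivative (linepath 0 b) (at t within {0..1})) \<le> 4 * norm b"
      if t: "t \<in> {0..1}"
    proof -
      have "(norm (linepath 0 b t))\<^sup>2 \<le> (1 / 2)\<^sup>2"
        using norm_le[OF t] by (intro power_mono) auto
      then have "2 / (1 - (norm (linepath 0 b t))\<^sup>2) \<le> 4"
        by (simp add: field_simps power2_eq_square)
      moreover have "vector_derivative (linepath 0 b) (at t within {0..1}) = b"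
        using t by (simp add: vector_derivative_linepath_within)
      ultimately show ?thesis
        by (simp only:) (intro mult_right_mono norm_ge_zero)
    qed
    \<comment> \<open>The pointwise bound holds only on the unit interval; elsewhere both integrands
      vanish through the indicator.\<close>
    then show "ennreal (2 / (1 - (norm (linepath 0 b t))\<^sup>2) *
        norm (vector_derivative (linepath 0 b) (at t within {0..1}))) * indicator {0..1} t
      \<le> ennreal (4 * norm b) * indicator {0..1} t"
      by (auto simp: indicator_def intro!: ennreal_leI)
  qed
  also have "\<dots> = ennreal (4 * norm b)"
    by (simp add: nn_integral_cmult_indicator)
  finally show ?thesis .
qed

lemma kobayashi_dist_le_poincare_dist:
  assumes "f holomorphic_on ball 0 1" "f ` ball 0 1 \<subseteq> X"
    and "a \<in> ball 0 1" "b \<in> ball 0 1"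
  shows "kobayashi_dist X (f a) (f b) \<le> poincare_dist a b"
proof -
  have "kobayashi_chain X (f a) (f b) 1 (\<lambda>_. a) (\<lambda>_. b) (\<lambda>_. f)"
    using assms by (simp add: kobayashi_chain_def)
  then have "kobayashi_dist X (f a) (f b) \<le> (\<Sum>i=1..1::nat. poincare_dist a b)"
    unfolding kobayashi_dist_def by (intro Inf_lower CollectI exI conjI) (rule refl)
  then show ?thesis
    by simp
qed

abbreviation punctured_disk :: "complex set" where
  "punctured_disk \<equiv> {z. 0 < norm z \<and> norm z < 1}"

text \<open>This real part is (1 - |\<zeta>|^2) / |1 - \<zeta>|^2: the Cayley transform maps the
  disk into the right half-plane.\<close>

lemma Re_cayley_pos:
  fixes \<zeta> :: complex
  assumes "norm \<zeta> < 1"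
  shows "0 < Re ((1 + \<zeta>) / (1 - \<zeta>))"
proof -
  have "(norm \<zeta>)\<^sup>2 < 1"
    using assms by (simp add: power_less_one_iff)
  then have "0 < (1 + Re \<zeta>) * (1 - Re \<zeta>) - Im \<zeta> * Im \<zeta>"
    unfolding cmod_power2 by (simp add: algebra_simps power2_eq_square)
  moreover have "1 - \<zeta> \<noteq> 0"
    using assms by auto
  then have "0 < (Re (1 - \<zeta>))\<^sup>2 + (Im (1 - \<zeta>))\<^sup>2"
    by (metis complex_neq_0)
  ultimately show ?thesis
    by (simp add: Re_divide)
qed

text \<open>A single disk suffices as a chain: the covering sends 0 to the centre and some
  \<open>b\<close> near 0 to \<open>w\<close>. The bound \<open>4 \<le> s\<close> together with
  \<pi> < 4 keeps \<open>b\<close> within radius 1/2.\<close>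

lemma kobayashi_dist_circle_le:
  assumes s: "4 \<le> s" and w: "norm w = exp (- s)"
  shows "kobayashi_dist punctured_disk (exp (- complex_of_real s)) w \<le> ennreal (2 * pi / s)"
proof -
  define f :: "complex \<Rightarrow> complex" where "f = (\<lambda>\<zeta>. exp (- complex_of_real s * ((1 + \<zeta>) / (1 - \<zeta>))))"
  define \<theta> where "\<theta> = Arg w"
  \<comment> \<open>the solution of \<open>(1 + b) / (1 - b) = 1 - \<i> \<theta> / s\<close>\<close>
  define b where "b = - \<i> * \<theta> / (2 * s - \<i> * \<theta>)"
  have "w \<noteq> 0"
    using w by auto
  have \<theta>: "\<bar>\<theta>\<bar> \<le> pi"
    using Arg_bounded[of w] by (auto simp: \<theta>_def)
  \<comment> \<open>The real part of the denominator is already 2s.\<close>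
  have den: "2 * s \<le> norm (2 * s - \<i> * \<theta>)"
    using abs_Re_le_cmod[of "2 * s - \<i> * \<theta>"] s by simp
  have "norm b = \<bar>\<theta>\<bar> / norm (2 * s - \<i> * \<theta>)"
    by (simp add: b_def norm_divide norm_mult)
  also have "\<dots> \<le> pi / (2 * s)"
    using \<theta> den s by (intro frac_le) auto
  finally have b: "norm b \<le> pi / (2 * s)" .
  also have "\<dots> \<le> 1 / 2"
    using s pi_less_4 by (simp add: field_simps)
  finally have b_half: "norm b \<le> 1 / 2" .
  have den0: "2 * s - \<i> * \<theta> \<noteq> 0"
    using den s by auto
  have "1 + b = (2 * s - 2 * \<i> * \<theta>) / (2 * s - \<i> * \<theta>)"
    and "1 - b = 2 * s / (2 * s - \<i> * \<theta>)"
    using den0 by (simp_all add: b_def field_simps)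
  then have "(1 + b) / (1 - b) = (2 * s - 2 * \<i> * \<theta>) / (2 * s)"
    using den0 s by simp
  then have "- complex_of_real s * ((1 + b) / (1 - b))
      = - complex_of_real s * ((2 * s - 2 * \<i> * \<theta>) / (2 * s))"
    by (rule arg_cong)
  also have "\<dots> = - s + \<i> * \<theta>"
    using s by (simp add: field_simps)
  finally have "- complex_of_real s * ((1 + b) / (1 - b)) = - s + \<i> * \<theta>" .
  then have "f b = exp (- complex_of_real s + \<i> * \<theta>)"
    by (simp add: f_def)
  also have "\<dots> = exp (- s) * exp (\<i> * \<theta>)"
    by (simp only: exp_add exp_of_real[symmetric] of_real_minus)
  also have "\<dots> = w"
    using Arg_eq[OF \<open>w \<noteq> 0\<close>] w by (simp add: \<theta>_def)
  finally have fb: "f b = w" .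
  have "f holomorphic_on ball 0 1"
    unfolding f_def by (intro holomorphic_intros) auto
  moreover have "f \<zeta> \<in> punctured_disk" if "\<zeta> \<in> ball 0 1" for \<zeta>
  proof -
    \<comment> \<open>The exponent has negative real part, so the modulus of its exponential lies
      strictly between 0 and 1.\<close>
    have "0 < s * Re ((1 + \<zeta>) / (1 - \<zeta>))"
      using Re_cayley_pos[of \<zeta>] that s by simp
    moreover have "Re (- complex_of_real s * ((1 + \<zeta>) / (1 - \<zeta>))) = - (s * Re ((1 + \<zeta>) / (1 - \<zeta>)))"
      by (simp only: mult_minus_left uminus_complex.sel times_complex.sel Re_complex_of_real
          Im_complex_of_real mult_zero_left diff_zero)
    ultimately show ?thesis
      by (simp add: f_def norm_exp_eq_Re)
  qed
  ultimately have "kobayashi_dist punctured_disk (f 0) (f b) \<le> poincare_dist 0 b"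
    using b_half by (intro kobayashi_dist_le_poincare_dist) auto
  also have "\<dots> \<le> ennreal (4 * norm b)"
    by (rule poincare_dist_0_le[OF b_half])
  also have "\<dots> \<le> ennreal (2 * pi / s)"
    using b s by (intro ennreal_leI) (simp add: field_simps)
  finally show ?thesis
    \<comment> \<open>\<open>fb\<close> must rewrite while \<open>f\<close> is still folded;
      unfolding then evaluates \<open>f 0\<close>.\<close>
    by (simp add: fb) (simp add: f_def)
qed

lemma kobayashi_injectivity_radius_at_le:
  assumes "4 \<le> s"
  shows "kobayashi_injectivity_radius_at punctured_disk (exp (- complex_of_real s))
    \<le> ennreal (tanh (pi / s))"
  unfolding kobayashi_injectivity_radius_at_def
proof (intro Sup_least, clarify)
  fix r :: real
  let ?B = "kobayashi_ball punctured_disk (exp (- complex_of_real s)) r"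
  assume r: "0 < r" and sc: "simply_connected ?B"
  have "r \<le> 2 * pi / s"
  proof (rule ccontr)
    assume "\<not> r \<le> 2 * pi / s"
    \<comment> \<open>The ball is open, so the strict inequality is what puts the whole circle
      inside it.\<close>
    then have lt: "ennreal (2 * pi / s) < ennreal r"
      using r by (intro ennreal_lessI) auto
    have "path_image (circlepath 0 (exp (- s))) \<subseteq> ?B"
    proof
      fix w :: complex
      assume "w \<in> path_image (circlepath 0 (exp (- s)))"
      then have w: "norm w = exp (- s)"
        by simp
      then show "w \<in> ?B"
        using kobayashi_dist_circle_le[OF assms w] lt assms
        by (auto simp: kobayashi_ball_def)
    qed
    moreover have "0 \<notin> ?B"
      by (simp add: kobayashi_ball_def)
    \<comment> \<open>Simple connectivity forces winding number 0 about the omitted point 0, but the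
      circle winds once around it.\<close>
    ultimately have "winding_number (circlepath 0 (exp (- s))) 0 = 0"
      using simply_connected_imp_winding_number_zero[OF sc] by simp
    then show False
      by (simp add: winding_number_circlepath)
  qed
  then have "r / 2 \<le> pi / s"
    by (simp add: field_simps)
  then show "ennreal (tanh (r / 2)) \<le> ennreal (tanh (pi / s))"
    by (intro ennreal_leI) simp
qed

theorem corollary3p9:
  shows "kobayashi_injectivity_radius {z :: complex. 0 < norm z \<and> norm z < 1} = 0"
proof -
  have "kobayashi_injectivity_radius punctured_disk \<le> ennreal (tanh (pi / s))"
    if s: "4 \<le> s" for s
  proof -
    have "exp (- complex_of_real s) \<in> punctured_disk"
      using s by (simp add: norm_exp_eq_Re)
    then have "kobayashi_injectivity_radius punctured_disk
        \<le> kobayashi_injectivity_radius_at punctured_disk (exp (- complex_of_real s))"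
      unfolding kobayashi_injectivity_radius_def by (rule INF_lower)
    then show ?thesis
      using kobayashi_injectivity_radius_at_le[OF s] by (rule order_trans)
  qed
  \<comment> \<open>Letting s tend to infinity moves the centre towards the puncture, and the bound
    tends to tanh 0 = 0.\<close>
  then have "\<forall>\<^sub>F s in at_top.
      kobayashi_injectivity_radius punctured_disk \<le> ennreal (tanh (pi / s))"
    by (intro eventually_at_top_linorderI[of 4])
  moreover have "((\<lambda>s::real. pi / s) \<longlongrightarrow> 0) at_top"
    by (rule real_tendsto_divide_at_top[OF tendsto_const filterlim_ident])
  then have "((\<lambda>s. ennreal (tanh (pi / s))) \<longlongrightarrow> ennreal (tanh 0)) at_top"
    by (intro tendsto_ennrealI tendsto_tanh) auto
  ultimately have "kobayashi_injectivity_radius punctured_disk \<le> ennreal (tanh 0)"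
    by (intro tendsto_lowerbound) auto
  then show ?thesis
    by simp
qed

end
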